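(* Let $\alpha\in\mathbb{R}^n$ and $\beta\in\mathbb{R}^m$ be nonzero vectors, $\xi(x_1,\dots,x_n)=\sum_{i=1}^n\alpha_ix_i$ and $\zeta(x_{n+1},\dots,x_{n+m})=\sum_{j=n+1}^{n+m}\beta_jx_j$. Let $\varphi>0$, $f>0$, $h$ be smooth functions on $\mathbb{R}^n$ depending only on $\xi$ and $\tau>0$, $u$ smooth functions on $\mathbb{R}^m$ depending only on $\zeta$, with $u$ non-constant. Suppose that $(\mathbb{R}^n\times_f\mathbb{R}^m,g,h,u,\lambda)$, with $g=\varphi^{-2}g_0+f^2\tau^{-2}g_0$ and with $h$, $u$ regarded as functions on the product through the projections to $\mathbb{R}^n$ and $\mathbb{R}^m$ respectively, is a GRHS. If $\|\alpha\|^2=0$, then the GRHS is steady, that is, $\lambda=0$.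
   Context: On $\mathbb{R}^n$ and on $\mathbb{R}^m$, $g_0$ denotes a semi-Euclidean metric, $(g_0)_{ij}=\epsilon_i\delta_{ij}$ with $\epsilon_i=\pm1$, and $\|\alpha\|^2=\sum_{i=1}^n\epsilon_i\alpha_i^2$. The metric $g$ is the warped product metric with base $(\mathbb{R}^n,\varphi^{-2}g_0)$, fiber $(\mathbb{R}^m,\tau^{-2}g_0)$ and warping function $f$. For a semi-Riemannian manifold $(M,g)$, smooth $u,h:M\to\mathbb{R}$ and $\lambda\in\mathbb{R}$, $(M,g,h,u,\lambda)$ is a gradient Ricci-harmonic soliton (GRHS) if there is a constant $\theta\ge0$ with $$Ric_g+Hess\,h-\theta\,\nabla u\otimes\nabla u=\lambda g,\qquad \Delta_gu-g(\nabla u,\nabla h)=0,$$ where $(\nabla u\otimes\nabla u)(X,Y)=X(u)Y(u)$ and $\Delta_g=\mathrm{tr}_gHess$. It is steady if $\lambda=0$. *)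

theory Defs
  imports "HOL-Analysis.Analysis"
begin

text \<open>In finite dimension, \<open>F\<close> is \<open>C^(k+1)\<close> iff it is differentiable and all its directional
  derivatives are \<open>C^k\<close>.\<close>

primrec C_k :: "nat \<Rightarrow> ('a::euclidean_space \<Rightarrow> real) \<Rightarrow> bool" where
  "C_k 0 F \<longleftrightarrow> continuous_on UNIV F"
| "C_k (Suc k) F \<longleftrightarrow>
     (\<forall>x. F differentiable (at x)) \<and> (\<forall>v. C_k k (\<lambda>x. frechet_derivative F (at x) v))"

definition smooth :: "('a::euclidean_space \<Rightarrow> real) \<Rightarrow> bool" where
  "smooth F \<longleftrightarrow> (\<forall>k. C_k k F)"

text \<open>The manifold is the whole space \<open>'a\<close> with its global linear chart, every tangent space being
  identified with \<open>'a\<close>; \<open>g x v w\<close> is the metric at the point \<open>x\<close> evaluated on the tangent vectors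
  \<open>v\<close> and \<open>w\<close>.\<close>

type_synonym 'a metric = "'a \<Rightarrow> 'a \<Rightarrow> 'a \<Rightarrow> real"

definition semi_riemannian_metric :: "'a::euclidean_space metric \<Rightarrow> bool" where
  "semi_riemannian_metric g \<longleftrightarrow>
     (\<forall>v w. smooth (\<lambda>x. g x v w)) \<and>
     (\<forall>x. bilinear (g x)) \<and>
     (\<forall>x v w. g x v w = g x w v) \<and>
     (\<forall>x v. (\<forall>w. g x v w = 0) \<longrightarrow> v = 0)"

definition sharp :: "'a::euclidean_space metric \<Rightarrow> 'a \<Rightarrow> ('a \<Rightarrow> real) \<Rightarrow> 'a" where
  "sharp g x \<omega> = (THE z. \<forall>y. g x z y = \<omega> y)"

definition grad :: "'a::euclidean_space metric \<Rightarrow> ('a \<Rightarrow> real) \<Rightarrow> 'a \<Rightarrow> 'a" where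
  "grad g u x = sharp g x (frechet_derivative u (at x))"

text \<open>The Levi-Civita connection applied to the constant vector fields \<open>v\<close> and \<open>w\<close>, which is given
  by the Koszul formula without bracket terms. On the coordinate fields these are the Christoffel
  symbols.\<close>

definition christoffel :: "'a::euclidean_space metric \<Rightarrow> 'a \<Rightarrow> 'a \<Rightarrow> 'a \<Rightarrow> 'a" where
  "christoffel g x v w = sharp g x (\<lambda>y.
     (frechet_derivative (\<lambda>p. g p w y) (at x) v
      + frechet_derivative (\<lambda>p. g p v y) (at x) w
      - frechet_derivative (\<lambda>p. g p v w) (at x) y) / 2)"

definition cov_deriv :: "'a::euclidean_space metric \<Rightarrow> 'a \<Rightarrow> 'a \<Rightarrow> ('a \<Rightarrow> 'a) \<Rightarrow> 'a" where
  "cov_deriv g x v Y = frechet_derivative Y (at x) v + christoffel g x v (Y x)"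

text \<open>The tensors below are evaluated on tangent vectors by extending these to constant vector
  fields. Constant fields commute, so the bracket term of the curvature vanishes:
  \<open>R(X,Y)Z = \<nabla>_X \<nabla>_Y Z - \<nabla>_Y \<nabla>_X Z\<close>. The convention \<open>Ric(Y,Z) = tr (X \<mapsto> R(X,Y)Z)\<close> makes the
  Ricci tensor of a round sphere positive.\<close>

definition riemann :: "'a::euclidean_space metric \<Rightarrow> 'a \<Rightarrow> 'a \<Rightarrow> 'a \<Rightarrow> 'a \<Rightarrow> 'a" where
  "riemann g x a b c =
     cov_deriv g x a (\<lambda>p. cov_deriv g p b (\<lambda>_. c))
     - cov_deriv g x b (\<lambda>p. cov_deriv g p a (\<lambda>_. c))"

definition op_trace :: "('a::euclidean_space \<Rightarrow> 'a) \<Rightarrow> real" where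
  "op_trace T = (\<Sum>b\<in>Basis. T b \<bullet> b)"

definition ricci :: "'a::euclidean_space metric \<Rightarrow> 'a \<Rightarrow> 'a \<Rightarrow> 'a \<Rightarrow> real" where
  "ricci g x v w = op_trace (\<lambda>a. riemann g x a v w)"

text \<open>\<open>Hess h (X,Y) = X(Y(h)) - (\<nabla>_X Y)(h)\<close>\<close>

definition hess :: "'a::euclidean_space metric \<Rightarrow> ('a \<Rightarrow> real) \<Rightarrow> 'a \<Rightarrow> 'a \<Rightarrow> 'a \<Rightarrow> real" where
  "hess g h x v w =
     frechet_derivative (\<lambda>p. frechet_derivative h (at p) w) (at x) v
     - frechet_derivative h (at x) (cov_deriv g x v (\<lambda>_. w))"

definition metric_trace :: "'a::euclidean_space metric \<Rightarrow> 'a \<Rightarrow> ('a \<Rightarrow> 'a \<Rightarrow> real) \<Rightarrow> real" where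
  "metric_trace g x B = op_trace (\<lambda>v. sharp g x (B v))"

definition laplacian :: "'a::euclidean_space metric \<Rightarrow> ('a \<Rightarrow> real) \<Rightarrow> 'a \<Rightarrow> real" where
  "laplacian g u x = metric_trace g x (hess g u x)"

definition GRHS ::
  "'a::euclidean_space metric \<Rightarrow> ('a \<Rightarrow> real) \<Rightarrow> ('a \<Rightarrow> real) \<Rightarrow> real \<Rightarrow> bool" where
  "GRHS g h u lam \<longleftrightarrow>
     semi_riemannian_metric g \<and> smooth u \<and> smooth h \<and>
     (\<exists>\<theta>\<ge>0. \<forall>x v w.
        ricci g x v w + hess g h x v w
          - \<theta> * (frechet_derivative u (at x) v * frechet_derivative u (at x) w)
        = lam * g x v w) \<and>
     (\<forall>x. laplacian g u x - g x (grad g u x) (grad g h x) = 0)"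

definition semi_euclidean :: "('n::finite \<Rightarrow> real) \<Rightarrow> (real^'n) metric" where
  "semi_euclidean \<epsilon> = (\<lambda>x v w. \<Sum>i\<in>UNIV. \<epsilon> i * v $ i * w $ i)"

definition sq_norm :: "('n::finite \<Rightarrow> real) \<Rightarrow> real^'n \<Rightarrow> real" where
  "sq_norm \<epsilon> \<alpha> = (\<Sum>i\<in>UNIV. \<epsilon> i * (\<alpha> $ i)\<^sup>2)"

definition conformal :: "('a \<Rightarrow> real) \<Rightarrow> 'a metric \<Rightarrow> 'a metric" where
  "conformal \<phi> g = (\<lambda>x v w. \<phi> x powi (-2) * g x v w)"

definition warped_product ::
  "'a metric \<Rightarrow> ('a \<Rightarrow> real) \<Rightarrow> 'b metric \<Rightarrow> ('a \<times> 'b) metric" where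
  "warped_product gB f gF =
     (\<lambda>x v w. gB (fst x) (fst v) (fst w) + (f (fst x))\<^sup>2 * gF (snd x) (snd v) (snd w))"

definition depends_only_on :: "('a \<Rightarrow> real) \<Rightarrow> ('a \<Rightarrow> real) \<Rightarrow> bool" where
  "depends_only_on F \<xi> \<longleftrightarrow> (\<exists>F'. \<forall>x. F x = F' (\<xi> x))"

end

theory Submission
  imports Defs
begin

text \<open>The gradient \<open>a\<close> of \<open>\<xi>\<close> with respect to \<open>g\<^sub>0\<close> has components \<open>\<epsilon>\<^sub>i \<alpha>\<^sub>i\<close>. When
  \<open>\<parallel>\<alpha>\<parallel>\<^sup>2 = 0\<close> it is tangent to the level sets of \<open>\<xi>\<close>, so that \<open>\<phi>\<close>, \<open>f\<close> and \<open>h\<close> are constant along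
  it. The Koszul formula then shows that the constant horizontal field \<open>W = (a, 0)\<close> is parallel for
  the warped product metric: the two terms of the formula that do not vanish at once are
  \<open>d(\<phi>\<^sup>-\<^sup>2)(v) d\<xi>(y)\<close> and \<open>d(\<phi>\<^sup>-\<^sup>2)(y) d\<xi>(v)\<close>, and they cancel because \<open>d(\<phi>\<^sup>-\<^sup>2)\<close> is a multiple
  of \<open>d\<xi>\<close> (lemma \<open>null_gradient_parallel\<close>).

  Consequently \<open>R(X,Y)W = 0\<close> and hence \<open>Ric(v,W) = 0\<close>. Moreover \<open>Hess h (v,W) = v(W(h)) = 0\<close>, and
  \<open>W(u) = 0\<close> since \<open>W\<close> is horizontal. The soliton equation evaluated on \<open>(v,W)\<close> thus reduces to
  \<open>\<lambda> g(v,W) = 0\<close>, while \<open>g(v,W) = \<phi>\<^sup>-\<^sup>2 d\<xi>(v)\<close>, and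
  \<open>d\<xi>(v) = \<alpha> \<bullet> \<alpha> \<noteq> 0\<close> for \<open>v = (\<alpha>, 0)\<close>.\<close>

lemma smooth_imp_differentiable:
  assumes "smooth F"
  shows "F differentiable (at x)"
proof -
  have "C_k (Suc 0) F" using assms unfolding smooth_def by blast
  then show ?thesis by simp
qed

lemma linear_frechet_derivative_smooth:
  assumes "smooth F"
  shows "linear (frechet_derivative F (at x))"
  using linear_frechet_derivative smooth_imp_differentiable[OF assms] by blast

lemma frechet_derivative_zero_along_line:
  fixes F :: "'a::euclidean_space \<Rightarrow> real"
  assumes "F differentiable (at x)" and "\<And>t. F (x + t *\<^sub>R z) = F x"
  shows "frechet_derivative F (at x) z = 0"
proof -
  let ?D = "frechet_derivative F (at x)"
  have "(F has_derivative ?D) (at (x + (0::real) *\<^sub>R z))"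
    using assms(1) by (simp add: frechet_derivative_works)
  moreover have "((\<lambda>t. x + t *\<^sub>R z) has_derivative (\<lambda>t. t *\<^sub>R z)) (at (0::real))"
    by (auto intro!: derivative_eq_intros)
  ultimately have "((\<lambda>t. F (x + t *\<^sub>R z)) has_derivative (\<lambda>t. ?D (t *\<^sub>R z))) (at (0::real))"
    using has_derivative_compose by blast
  moreover have "((\<lambda>t. F (x + t *\<^sub>R z)) has_derivative (\<lambda>t. 0)) (at (0::real))"
    using assms(2) by simp
  ultimately have "(\<lambda>t::real. ?D (t *\<^sub>R z)) = (\<lambda>t. 0)"
    by (rule has_derivative_unique)
  from fun_cong[OF this, of 1] show ?thesis by simp
qed

lemma sharp_zero:
  assumes "semi_riemannian_metric g"
  shows "sharp g x (\<lambda>y. 0) = 0"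
  unfolding sharp_def
proof (rule the_equality)
  have "bilinear (g x)" using assms unfolding semi_riemannian_metric_def by blast
  then show "\<forall>y. g x 0 y = 0" by (simp add: bilinear_lzero)
next
  fix z assume "\<forall>y. g x z y = 0"
  then show "z = 0" using assms unfolding semi_riemannian_metric_def by blast
qed

text \<open>A constant vector field \<open>W\<close> is parallel iff all \<open>christoffel g x v W\<close> vanish.\<close>

lemma ricci_parallel:
  fixes g :: "'a::euclidean_space metric"
  assumes metric: "semi_riemannian_metric g" and parallel: "\<And>x v. christoffel g x v W = 0"
  shows "ricci g x v W = 0"
proof -
  have cov0: "cov_deriv g p b (\<lambda>_. 0) = 0" for p b
  proof -
    have bil: "bilinear (g q)" and smooth_g: "smooth (\<lambda>q. g q v w)" for q v w
      using metric unfolding semi_riemannian_metric_def by blast+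
    have "christoffel g p b 0 = 0"
      unfolding christoffel_def
      by (simp add: bilinear_lzero[OF bil] bilinear_rzero[OF bil] sharp_zero[OF metric]
          linear_0[OF linear_frechet_derivative_smooth]
          smooth_g)
    then show ?thesis by (simp add: cov_deriv_def)
  qed
  have "cov_deriv g p b (\<lambda>_. W) = 0" for p b
    by (simp add: cov_deriv_def parallel)
  then show ?thesis
    by (simp add: ricci_def riemann_def op_trace_def cov0)
qed

lemma hess_parallel:
  fixes g :: "'a::euclidean_space metric"
  assumes "smooth h" and "\<And>x v. christoffel g x v W = 0"
    and "\<And>x. frechet_derivative h (at x) W = 0"
  shows "hess g h x v W = 0"
  using assms by (simp add: hess_def cov_deriv_def linear_0[OF linear_frechet_derivative_smooth])

text \<open>The hypotheses on \<open>P\<close> and \<open>\<eta>\<close> say that \<open>W\<close> is, up to the factor \<open>P\<close>, the metric dual of the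
  constant form \<open>\<eta>\<close>, where \<open>P\<close> is constant along the hyperplanes \<open>ker \<eta>\<close>. If in addition all
  components of the metric are constant along \<open>W\<close>, then \<open>W\<close> is parallel.\<close>

lemma null_gradient_parallel:
  fixes g :: "'a::euclidean_space metric"
  assumes metric: "semi_riemannian_metric g"
    and dual: "\<And>p y. g p W y = P p * \<eta> y"
    and \<eta>: "linear \<eta>"
    and P_const: "\<And>p z. \<eta> z = 0 \<Longrightarrow> P (p + z) = P p"
    and g_const: "\<And>p v y t. g (p + t *\<^sub>R W) v y = g p v y"
  shows "christoffel g x v W = 0"
proof -
  have smooth_g: "smooth (\<lambda>p. g p v w)" and sym: "g p v w = g p w v" for p v w
    using metric unfolding semi_riemannian_metric_def by blast+
  \<comment> \<open>\<open>D y z\<close> is the derivative of \<open>g(W,y)\<close> in the direction \<open>z\<close>; the Koszul formula needs its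
    symmetry.\<close>
  define D where "D y = frechet_derivative (\<lambda>p. g p W y) (at x)" for y
  have linD: "linear (D y)" for y
    unfolding D_def by (rule linear_frechet_derivative_smooth[OF smooth_g])
  have D_ker: "D y z = 0" if "\<eta> z = 0" for y z
    unfolding D_def
  proof (rule frechet_derivative_zero_along_line)
    show "(\<lambda>p. g p W y) differentiable (at x)"
      by (rule smooth_imp_differentiable[OF smooth_g])
    show "g (x + t *\<^sub>R z) W y = g x W y" for t
      using that by (simp add: dual P_const linear_scale[OF \<eta>])
  qed
  have D_scale: "\<eta> y * D y' z = \<eta> y' * D y z" for y y' z
  proof -
    have "(\<lambda>p. \<eta> y * g p W y') = (\<lambda>p. \<eta> y' * g p W y)"
      by (simp add: dual mult_ac)
    moreover have "((\<lambda>p. c * g p W b) has_derivative (\<lambda>z. c * D b z)) (at x)" for c b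
      unfolding D_def
      using smooth_imp_differentiable[OF smooth_g]
      by (intro has_derivative_mult_right) (simp add: frechet_derivative_works[symmetric])
    ultimately have "(\<lambda>z. \<eta> y * D y' z) = (\<lambda>z. \<eta> y' * D y z)"
      using has_derivative_unique by metis
    then show ?thesis by meson
  qed
  have swap: "D y z = D z y" for y z
  proof -
    \<comment> \<open>\<open>\<eta> z y - \<eta> y z\<close> lies in the kernel of \<open>\<eta>\<close>.\<close>
    have "D b (\<eta> z *\<^sub>R y - \<eta> y *\<^sub>R z) = 0" for b
      by (rule D_ker) (simp add: linear_diff[OF \<eta>] linear_scale[OF \<eta>])
    then have ker: "\<eta> z * D b y = \<eta> y * D b z" for b
      by (simp add: linear_diff[OF linD] linear_scale[OF linD])
    show ?thesis
    proof (cases "\<eta> y = 0 \<and> \<eta> z = 0")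
      case True
      then show ?thesis by (simp add: D_ker)
    next
      case False
      then show ?thesis
        using ker D_scale[of z y] D_scale[of y z] by (metis mult_cancel_left)
    qed
  qed
  have "frechet_derivative (\<lambda>p. g p v y) (at x) W = 0" for y
    using smooth_imp_differentiable[OF smooth_g] g_const
    by (rule frechet_derivative_zero_along_line)
  moreover have "frechet_derivative (\<lambda>p. g p v W) (at x) y = D v y" for y
    by (simp add: D_def sym[of _ v W])
  ultimately show ?thesis
    unfolding christoffel_def D_def[symmetric]
    by (simp add: swap[of _ v] sharp_zero[OF metric])
qed

theorem corollary1p11:
  fixes \<epsilon> :: "'n::finite \<Rightarrow> real" and \<delta> :: "'m::finite \<Rightarrow> real"
    and \<alpha> :: "real^'n" and \<beta> :: "real^'m"
    and \<xi> \<phi> f h :: "real^'n \<Rightarrow> real"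
    and \<zeta> \<tau> u :: "real^'m \<Rightarrow> real"
    and lam :: real
  assumes "\<And>i. \<epsilon> i = 1 \<or> \<epsilon> i = -1" and "\<And>j. \<delta> j = 1 \<or> \<delta> j = -1"
    and "\<alpha> \<noteq> 0" and "\<beta> \<noteq> 0"
    and "\<And>x. \<xi> x = (\<Sum>i\<in>UNIV. \<alpha> $ i * x $ i)"
    and "\<And>y. \<zeta> y = (\<Sum>j\<in>UNIV. \<beta> $ j * y $ j)"
    and "smooth \<phi>" and "\<And>x. \<phi> x > 0" and "depends_only_on \<phi> \<xi>"
    and "smooth f" and "\<And>x. f x > 0" and "depends_only_on f \<xi>"
    and "smooth h" and "depends_only_on h \<xi>"
    and "smooth \<tau>" and "\<And>y. \<tau> y > 0" and "depends_only_on \<tau> \<zeta>"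
    and "smooth u" and "depends_only_on u \<zeta>" and "\<not> u constant_on UNIV"
    and "GRHS
           (warped_product (conformal \<phi> (semi_euclidean \<epsilon>)) f (conformal \<tau> (semi_euclidean \<delta>)))
           (h \<circ> fst) (u \<circ> snd) lam"
    and "sq_norm \<epsilon> \<alpha> = 0"
  shows "lam = 0"
proof -
  let ?g = "warped_product (conformal \<phi> (semi_euclidean \<epsilon>)) f (conformal \<tau> (semi_euclidean \<delta>))"
  define a :: "real^'n" where "a = (\<chi> i. \<epsilon> i * \<alpha> $ i)"
  define W :: "(real^'n) \<times> (real^'m)" where "W = (a, 0)"
  define \<eta> :: "(real^'n) \<times> (real^'m) \<Rightarrow> real" where "\<eta> y = \<alpha> \<bullet> fst y" for y
  have \<xi>_eq: "\<xi> x = \<alpha> \<bullet> x" for x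
    using assms(5) by (simp add: inner_vec_def)
  have null: "\<alpha> \<bullet> a = 0"
    using assms(22) by (simp add: sq_norm_def a_def inner_vec_def power2_eq_square mult_ac)
  have const: "F (x + z) = F x" if "depends_only_on F \<xi>" "\<alpha> \<bullet> z = 0" for F :: "real^'n \<Rightarrow> real" and x z
  proof -
    have "\<xi> (x + z) = \<xi> x" using that(2) by (simp add: \<xi>_eq inner_add_right)
    then show ?thesis using that(1) unfolding depends_only_on_def by metis
  qed
  from assms(21) obtain \<theta> where metric: "semi_riemannian_metric ?g"
    and smooth_u: "smooth (u \<circ> snd :: (real^'n) \<times> (real^'m) \<Rightarrow> real)"
    and smooth_h: "smooth (h \<circ> fst :: (real^'n) \<times> (real^'m) \<Rightarrow> real)"
    and soliton: "\<And>x v w. ricci ?g x v w + hess ?g (h \<circ> fst) x v w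
        - \<theta> * (frechet_derivative (u \<circ> snd) (at x) v * frechet_derivative (u \<circ> snd) (at x) w)
        = lam * ?g x v w"
    unfolding GRHS_def by blast
  have dual: "?g p W y = \<phi> (fst p) powi (-2) * \<eta> y" for p y
  proof -
    have "semi_euclidean \<epsilon> (fst p) a (fst y) = \<alpha> \<bullet> fst y"
      unfolding semi_euclidean_def inner_vec_def
    proof (rule sum.cong)
      fix i
      show "\<epsilon> i * a $ i * fst y $ i = \<alpha> $ i \<bullet> fst y $ i"
        using assms(1)[of i] by (auto simp: a_def)
    qed simp
    then show ?thesis
      by (simp add: W_def \<eta>_def warped_product_def conformal_def)
         (simp add: semi_euclidean_def)
  qed
  have parallel: "christoffel ?g x v W = 0" for x v
  proof (rule null_gradient_parallel[OF metric dual])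
    show "linear \<eta>"
      by (rule linearI) (simp_all add: \<eta>_def inner_add_right)
    show "\<phi> (fst (p + z)) powi (-2) = \<phi> (fst p) powi (-2)" if "\<eta> z = 0" for p z
      using that const[OF assms(9)] by (simp add: \<eta>_def)
    show "?g (p + t *\<^sub>R W) v y = ?g p v y" for p v y t
      using const[OF assms(9)] const[OF assms(12)] null
      by (simp add: W_def warped_product_def conformal_def semi_euclidean_def)
  qed
  have Wh: "frechet_derivative (h \<circ> fst) (at x) W = 0" for x
    using smooth_imp_differentiable[OF smooth_h]
    by (rule frechet_derivative_zero_along_line) (simp add: W_def const[OF assms(14)] null)
  have Wu: "frechet_derivative (u \<circ> snd) (at x) W = 0" for x
    using smooth_imp_differentiable[OF smooth_u]
    by (rule frechet_derivative_zero_along_line) (simp add: W_def)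
  have "lam * ?g 0 (\<alpha>, 0) W = 0"
    using soliton[of 0 "(\<alpha>, 0)" W]
    by (simp add: ricci_parallel[OF metric parallel] hess_parallel[OF smooth_h parallel Wh] Wu)
  moreover have "?g 0 (\<alpha>, 0) W = ?g 0 W (\<alpha>, 0)"
    using metric unfolding semi_riemannian_metric_def by blast
  then have "?g 0 (\<alpha>, 0) W = \<phi> 0 powi (-2) * (\<alpha> \<bullet> \<alpha>)"
    by (simp add: dual \<eta>_def)
  then have "?g 0 (\<alpha>, 0) W \<noteq> 0"
    using assms(3) assms(8)[of 0] by simp
  ultimately show ?thesis by simp
qed

end
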